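(* Let $x,\tilde x\in\mathbb{E}$ and $s,\tilde s\in\mathbb{E}^*$ satisfy the following conditions, where $\delta_P:=x-\mu\tilde x$ and $\delta_D:=s-\mu\tilde s$: - $0<\langle\tilde s,x\rangle=\langle s,\tilde x\rangle=:\vartheta$; - $0<\langle s,x\rangle=:\vartheta\mu$; - $0<\langle\tilde s,\tilde x\rangle=:\vartheta\tilde\mu$; - $\langle\delta_D,\delta_P\rangle>0$. Let $H$ be a symmetric positive-definite matrix (representing a self-adjoint positive-definite map $\mathbb{E}^*\to\mathbb{E}$). Define $$H_1:=H+\frac{1}{\langle s,x\rangle}xx^\top-\frac{1}{\langle s,Hs\rangle}Hss^\top H,$$ $$H_2:=H_1+\frac{1}{\langle\delta_D,\delta_P\rangle}\delta_P\delta_P^\top-\frac{1}{\langle\delta_D,H_1\delta_D\rangle}H_1\delta_D\delta_D^\top H_1.$$ Then $H_2$ is symmetric, positive-definite, maps $s$ to $x$, and maps $\tilde s$ to $\tilde x$.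
   Context: $\mathbb{E}$ is a finite-dimensional real vector space with dual $\mathbb{E}^*$ and pairing $\langle\cdot,\cdot\rangle$; both are identified with $\mathbb{R}^n$ via a fixed inner product, so linear maps $\mathbb{E}^*\to\mathbb{E}$ are $n\times n$ matrices. For $a,b\in\mathbb{E}$, $ab^\top$ denotes the map $\mathbb{E}^*\to\mathbb{E}$, $u\mapsto\langle u,b\rangle a$; $Hss^\top H$ means $(Hs)(Hs)^\top$, and similarly $H_1\delta_D\delta_D^\top H_1$ means $(H_1\delta_D)(H_1\delta_D)^\top$. *)

theory Defs
  imports "HOL-Analysis.Analysis"
begin

text \<open>
  The space and its dual are both identified with \<^typ>\<open>real^'n\<close> through an orthonormal
  basis of the fixed inner product, so the pairing is \<^const>\<open>inner\<close>, linear maps from the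
  dual to the space are matrices of type \<^typ>\<open>real^'n^'n\<close>, and such a map is self-adjoint
  iff its matrix is symmetric.
\<close>

text \<open>The rank-one matrix $a b^T$, representing the map $u \mapsto \langle u, b\rangle a$.\<close>
definition outer_product :: "real^'n \<Rightarrow> real^'n \<Rightarrow> real^'n^'n"  (infixl "\<otimes>\<^sub>o" 75) where
  "a \<otimes>\<^sub>o b = matrix (\<lambda>u. (u \<bullet> b) *\<^sub>R a)"

definition symmetric_mat :: "real^'n^'n \<Rightarrow> bool" where
  "symmetric_mat A \<longleftrightarrow> transpose A = A"

text \<open>Positivity of the quadratic form alone; symmetry is always required separately.\<close>
definition positive_definite_mat :: "real^'n^'n \<Rightarrow> bool" where
  "positive_definite_mat A \<longleftrightarrow> (\<forall>u. u \<noteq> 0 \<longrightarrow> 0 < u \<bullet> (A *v u))"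

lemma outer_product_vector_mult: "(a \<otimes>\<^sub>o b) *v u = (u \<bullet> b) *\<^sub>R a"
proof -
  have "linear (\<lambda>u. (u \<bullet> b) *\<^sub>R a)"
    by (auto intro!: linearI simp: inner_add_left algebra_simps)
  then show ?thesis
    unfolding outer_product_def by (simp add: matrix_works)
qed

lemma outer_product_nth: "(a \<otimes>\<^sub>o b) $ i $ j = a $ i * b $ j"
  by (simp add: outer_product_def matrix_def inner_axis')

end

theory Submission
  imports Defs
begin

text \<open>
  Each of the two steps is a BFGS update: the update of a symmetric positive-definite matrix by a
  pair with positive pairing is again symmetric positive-definite and satisfies the secant equation.
  The first update gives \<open>H\<^sub>1 s = x\<close>. Since \<open>\<langle>s, \<delta>\<^sub>P\<rangle> = 0\<close> and \<open>\<langle>\<delta>\<^sub>D, H\<^sub>1 s\<rangle> = \<langle>\<delta>\<^sub>D, x\<rangle> = 0\<close>, the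
  second update leaves the image of \<open>s\<close> unchanged, and its own secant equation then determines the
  image of the other dual vector because \<open>\<mu> \<noteq> 0\<close>.
\<close>

text \<open>The direct BFGS formula: \<open>H\<close> is the Hessian approximation, \<open>s\<close>
  the step and \<open>x\<close> the gradient difference.\<close>

definition bfgs_update :: "real^'n^'n \<Rightarrow> real^'n \<Rightarrow> real^'n \<Rightarrow> real^'n^'n" where
  "bfgs_update H s x = H + (1 / (s \<bullet> x)) *\<^sub>R (x \<otimes>\<^sub>o x)
     - (1 / (s \<bullet> (H *v s))) *\<^sub>R ((H *v s) \<otimes>\<^sub>o (H *v s))"

lemma bfgs_update_mult:
  "bfgs_update H s x *v u =
     H *v u + ((u \<bullet> x) / (s \<bullet> x)) *\<^sub>R x - ((u \<bullet> (H *v s)) / (s \<bullet> (H *v s))) *\<^sub>R (H *v s)"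
  by (simp add: bfgs_update_def matrix_vector_mult_add_rdistrib
      matrix_vector_mult_diff_rdistrib scaleR_matrix_vector_assoc[symmetric]
      outer_product_vector_mult)

lemma symmetric_mat_inner:
  assumes "symmetric_mat A"
  shows "u \<bullet> (A *v v) = v \<bullet> (A *v u)"
  using assms dot_lmul_matrix[of v A u]
  by (metis symmetric_mat_def inner_commute transpose_matrix_vector)

lemma symmetric_bfgs_update:
  assumes "symmetric_mat H"
  shows "symmetric_mat (bfgs_update H s x)"
proof -
  have "H $ i $ j = H $ j $ i" for i j
    using assms by (simp add: symmetric_mat_def transpose_def vec_eq_iff)
  then show ?thesis
    by (simp add: symmetric_mat_def bfgs_update_def vec_eq_iff transpose_def
        outer_product_nth mult.commute)
qed

text \<open>At \<open>s\<close> itself both correction coefficients equal 1, so the two copies of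
  \<open>H *v s\<close> cancel; positive definiteness keeps the second denominator nonzero.\<close>

lemma bfgs_update_secant:
  assumes "positive_definite_mat H" and "0 < s \<bullet> x"
  shows "bfgs_update H s x *v s = x"
proof -
  have "s \<noteq> 0" using assms(2) by auto
  then have "0 < s \<bullet> (H *v s)"
    using assms(1) by (simp add: positive_definite_mat_def)
  with assms(2) show ?thesis by (simp add: bfgs_update_mult)
qed

text \<open>The new form splits into the old form at a projected vector plus a square over
  \<open>s \<bullet> x\<close>. The projection vanishes only on the line through \<open>s\<close>,
  and there the square is positive away from 0.\<close>

lemma positive_definite_bfgs_update:
  fixes H :: "real^'n^'n"
  assumes sym: "symmetric_mat H" and pd: "positive_definite_mat H" and sx: "0 < s \<bullet> x"
  shows "positive_definite_mat (bfgs_update H s x)"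
  unfolding positive_definite_mat_def
proof (intro allI impI)
  fix u :: "real^'n"
  assume "u \<noteq> 0"
  have "s \<noteq> 0" using sx by auto
  then have sHs: "0 < s \<bullet> (H *v s)"
    using pd by (simp add: positive_definite_mat_def)
  \<comment> \<open>Subtracting the \<open>H\<close>-orthogonal projection of \<open>u\<close> onto \<open>s\<close> completes the square.\<close>
  define t where "t = (u \<bullet> (H *v s)) / (s \<bullet> (H *v s))"
  define v where "v = u - t *\<^sub>R s"
  have uHs: "u \<bullet> (H *v s) = t * (s \<bullet> (H *v s))"
    using sHs by (simp add: t_def)
  have "v \<bullet> (H *v v) = u \<bullet> (H *v u) - t * (u \<bullet> (H *v s))"
    using symmetric_mat_inner[OF sym, of s u]
    by (simp add: v_def matrix_vector_mult_diff_distrib matrix_vector_mult_scaleR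
        inner_diff_left inner_diff_right uHs algebra_simps)
  then have quad: "u \<bullet> (bfgs_update H s x *v u) = v \<bullet> (H *v v) + (u \<bullet> x)\<^sup>2 / (s \<bullet> x)"
    by (simp add: bfgs_update_mult t_def inner_add_right inner_diff_right power2_eq_square)
  show "0 < u \<bullet> (bfgs_update H s x *v u)"
  proof (cases "v = 0")
    case True
    then have u: "u = t *\<^sub>R s" by (simp add: v_def)
    with \<open>u \<noteq> 0\<close> sx have "u \<bullet> x \<noteq> 0" by auto
    with True sx show ?thesis by (simp add: quad)
  next
    case False
    then have "0 < v \<bullet> (H *v v)"
      using pd by (simp add: positive_definite_mat_def)
    moreover have "0 \<le> (u \<bullet> x)\<^sup>2 / (s \<bullet> x)" using sx by simp
    ultimately show ?thesis by (simp add: quad)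
  qed
qed

theorem theorem4p1:
  fixes x x' s s' \<delta>P \<delta>D :: "real^'n"
    and \<theta> \<mu> \<mu>' :: real
    and H H1 H2 :: "real^'n^'n"
  assumes "0 < s' \<bullet> x" and "s' \<bullet> x = s \<bullet> x'" and "s \<bullet> x' = \<theta>"
    and "0 < s \<bullet> x" and "s \<bullet> x = \<theta> * \<mu>"
    and "0 < s' \<bullet> x'" and "s' \<bullet> x' = \<theta> * \<mu>'"
    and "\<delta>P = x - \<mu> *\<^sub>R x'"
    and "\<delta>D = s - \<mu> *\<^sub>R s'"
    and "0 < \<delta>D \<bullet> \<delta>P"
    and "symmetric_mat H" and "positive_definite_mat H"
    and "H1 = H + (1 / (s \<bullet> x)) *\<^sub>R (x \<otimes>\<^sub>o x)
                - (1 / (s \<bullet> (H *v s))) *\<^sub>R ((H *v s) \<otimes>\<^sub>o (H *v s))"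
    and "H2 = H1 + (1 / (\<delta>D \<bullet> \<delta>P)) *\<^sub>R (\<delta>P \<otimes>\<^sub>o \<delta>P)
                 - (1 / (\<delta>D \<bullet> (H1 *v \<delta>D))) *\<^sub>R ((H1 *v \<delta>D) \<otimes>\<^sub>o (H1 *v \<delta>D))"
  shows "symmetric_mat H2 \<and> positive_definite_mat H2 \<and> H2 *v s = x \<and> H2 *v s' = x'"
proof -
  have H1: "H1 = bfgs_update H s x" and H2: "H2 = bfgs_update H1 \<delta>D \<delta>P"
    by (simp_all add: bfgs_update_def assms(13,14))
  have sym1: "symmetric_mat H1" and pd1: "positive_definite_mat H1" and H1s: "H1 *v s = x"
    unfolding H1
    using assms(4,11,12) symmetric_bfgs_update positive_definite_bfgs_update bfgs_update_secant
    by blast+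
  have sym2: "symmetric_mat H2" and pd2: "positive_definite_mat H2" and H2D: "H2 *v \<delta>D = \<delta>P"
    unfolding H2
    using assms(10) sym1 pd1 symmetric_bfgs_update positive_definite_bfgs_update
      bfgs_update_secant by blast+
  \<comment> \<open>This product and the next are the numerators in \<open>bfgs_update_mult\<close>
    for the second update at \<open>s\<close>. Both vanish because \<mu> is the ratio of
    \<open>s \<bullet> x\<close> to the common cross pairing \<theta>.\<close>
  have "s \<bullet> \<delta>P = 0"
    using assms(3,5,8) by (simp add: inner_diff_right)
  moreover have "s \<bullet> (H1 *v \<delta>D) = 0"
  proof -
    have "s \<bullet> (H1 *v \<delta>D) = \<delta>D \<bullet> x"
      using symmetric_mat_inner[OF sym1, of s \<delta>D] H1s by simp
    also have "\<dots> = 0"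
      using assms(2,3,5,9) by (simp add: inner_diff_left)
    finally show ?thesis .
  qed
  ultimately have H2s: "H2 *v s = x"
    by (simp add: H2 bfgs_update_mult H1s)
  have "\<mu> \<noteq> 0" using assms(4,5) by auto
  \<comment> \<open>Expanding \<open>H2 *v \<delta>D = \<delta>P\<close> by linearity, the terms
    \<open>H2 *v s\<close> and \<open>x\<close> cancel.\<close>
  moreover have "\<mu> *\<^sub>R (H2 *v s') = \<mu> *\<^sub>R x'"
    using H2D H2s by (simp add: assms(8,9) matrix_vector_mult_diff_distrib
        matrix_vector_mult_scaleR)
  ultimately have "H2 *v s' = x'" by simp
  with sym2 pd2 H2s show ?thesis by blast
qed

end
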